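(* Suppose that $p$ is a polynomial with complex coefficients. Then $\mathcal{M}(p)$ has at most finitely many discontinuities; that is, there are at most finitely many connected components $\Gamma$ of $\mathcal{M}(p)$ such that $\min\{|z| : z \in \Gamma\} > 0$.
   Context: For an entire function $f:\mathbb{C}\to\mathbb{C}$ (in particular a polynomial), the maximum modulus is $M(r,f) := \max_{|z|=r}|f(z)|$ for $r \ge 0$, and the maximum modulus set is $\mathcal{M}(f) := \{z \in \mathbb{C} : |f(z)| = M(|z|,f)\}$, which is a closed set. For $r>0$, we say that $\mathcal{M}(f)$ has a discontinuity of modulus $r$ if there exists a connected component $\Gamma$ of $\mathcal{M}(f)$ such that $\min\{|z| : z \in \Gamma\} = r$. There may be more than one discontinuity of the same modulus: discontinuities are counted by the components $\Gamma$ that give rise to them, so they correspond bijectively to the connected components of $\mathcal{M}(f)$ that do not contain $0$. *)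

theory Defs
  imports "HOL-Analysis.Analysis" "HOL-Computational_Algebra.Polynomial"
begin

text \<open>The supremum is a maximum for continuous \<open>f\<close> and \<open>r \<ge> 0\<close>, see
  \<open>max_modulus_attained\<close> and \<open>max_modulus_upper\<close> below. For \<open>r < 0\<close> the sphere is
  empty and the value is irrelevant.\<close>

definition max_modulus :: "real \<Rightarrow> (complex \<Rightarrow> complex) \<Rightarrow> real" where
  "max_modulus r f = (SUP z\<in>sphere 0 r. cmod (f z))"

definition max_modulus_set :: "(complex \<Rightarrow> complex) \<Rightarrow> complex set" where
  "max_modulus_set f = {z. cmod (f z) = max_modulus (cmod z) f}"

text \<open>The last two conjuncts say that \<open>r\<close> is the minimum of \<open>{|z| : z \<in> \<Gamma>}\<close>. The component
  \<open>\<Gamma>\<close> is an argument because several components may have the same minimal modulus, and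
  these count as different discontinuities.\<close>

definition discontinuity_of_modulus ::
    "(complex \<Rightarrow> complex) \<Rightarrow> real \<Rightarrow> complex set \<Rightarrow> bool" where
  "discontinuity_of_modulus f r \<Gamma> \<longleftrightarrow>
     \<Gamma> \<in> components (max_modulus_set f) \<and> r > 0 \<and>
     r \<in> cmod ` \<Gamma> \<and> (\<forall>z\<in>\<Gamma>. r \<le> cmod z)"

lemma max_modulus_upper:
  assumes "continuous_on UNIV f"
  shows "cmod (f z) \<le> max_modulus (cmod z) f"
proof -
  have "compact ((\<lambda>z. cmod (f z)) ` sphere 0 (cmod z))"
    by (intro compact_continuous_image continuous_on_norm continuous_on_subset[OF assms]) auto
  then have "bdd_above ((\<lambda>z. cmod (f z)) ` sphere 0 (cmod z))"
    by (intro bounded_imp_bdd_above compact_imp_bounded)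
  then show ?thesis
    unfolding max_modulus_def by (intro cSUP_upper) auto
qed

lemma max_modulus_attained:
  assumes "continuous_on UNIV f" "r \<ge> 0"
  obtains z where "cmod z = r" "cmod (f z) = max_modulus r f"
proof -
  have "compact ((\<lambda>z. cmod (f z)) ` sphere 0 r)"
    by (intro compact_continuous_image continuous_on_norm continuous_on_subset[OF assms(1)]) auto
  moreover have "(\<lambda>z. cmod (f z)) ` sphere 0 r \<noteq> {}"
    using assms(2) by simp
  ultimately have "max_modulus r f \<in> (\<lambda>z. cmod (f z)) ` sphere 0 r"
    unfolding max_modulus_def
    by (intro closed_contains_Sup compact_imp_closed bounded_imp_bdd_above compact_imp_bounded)
  then show ?thesis
    using that by force
qed

lemma closed_max_modulus_set:
  assumes cont: "continuous_on UNIV f"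
  shows "closed (max_modulus_set f)"
proof -
  have rot: "cmod (f (of_real (cmod z) * w)) \<le> max_modulus (cmod z) f" if "cmod w = 1" for z w
    using max_modulus_upper[OF cont, of "of_real (cmod z) * w"] that by (simp add: norm_mult)
  have eq: "max_modulus_set f =
      (\<Inter>w\<in>sphere 0 1. {z. cmod (f (of_real (cmod z) * w)) \<le> cmod (f z)})"
  proof (intro equalityI subsetI)
    fix z assume "z \<in> max_modulus_set f"
    then show "z \<in> (\<Inter>w\<in>sphere 0 1. {z. cmod (f (of_real (cmod z) * w)) \<le> cmod (f z)})"
      using rot by (auto simp: max_modulus_set_def)
  next
    fix z assume z: "z \<in> (\<Inter>w\<in>sphere 0 1. {z. cmod (f (of_real (cmod z) * w)) \<le> cmod (f z)})"
    obtain u where u: "cmod u = cmod z" "cmod (f u) = max_modulus (cmod z) f"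
      using max_modulus_attained[OF cont norm_ge_zero] by metis
    have "cmod (f u) \<le> cmod (f z)"
    proof (cases "z = 0")
      case False
      define w where "w = u / of_real (cmod z)"
      have "cmod w = 1" "of_real (cmod z) * w = u"
        using False u(1) by (auto simp: w_def norm_divide)
      with z show ?thesis by force
    qed (use u in simp)
    then show "z \<in> max_modulus_set f"
      using u(2) max_modulus_upper[OF cont, of z] by (simp add: max_modulus_set_def)
  qed
  show ?thesis
    unfolding eq
    by (intro closed_INT ballI closed_Collect_le continuous_on_norm
        continuous_on_compose2[OF cont] continuous_intros) auto
qed

lemma discontinuity_iff_zero_notin:
  assumes cont: "continuous_on UNIV f"
  shows "(\<exists>r. discontinuity_of_modulus f r \<Gamma>) \<longleftrightarrow> \<Gamma> \<in> components (max_modulus_set f) \<and> 0 \<notin> \<Gamma>"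
proof
  assume "\<exists>r. discontinuity_of_modulus f r \<Gamma>"
  then show "\<Gamma> \<in> components (max_modulus_set f) \<and> 0 \<notin> \<Gamma>"
    by (force simp: discontinuity_of_modulus_def)
next
  assume \<Gamma>: "\<Gamma> \<in> components (max_modulus_set f) \<and> 0 \<notin> \<Gamma>"
  then have "closed \<Gamma>" "\<Gamma> \<noteq> {}"
    using closed_components[OF closed_max_modulus_set[OF cont]] in_components_nonempty by auto
  then obtain x where x: "x \<in> \<Gamma>" "\<And>y. y \<in> \<Gamma> \<Longrightarrow> dist 0 x \<le> dist 0 y"
    using distance_attains_inf by metis
  then have "discontinuity_of_modulus f (cmod x) \<Gamma>"
    using \<Gamma> by (auto simp: discontinuity_of_modulus_def)
  then show "\<exists>r. discontinuity_of_modulus f r \<Gamma>" ..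
qed

end

theory Submission
  imports Defs "HOL-Computational_Algebra.Fundamental_Theorem_Algebra"
begin

text \<open>
  Write a point of the plane as \<open>r w\<close> with \<open>r > 0\<close> and \<open>|w| = 1\<close>. Factors \<open>z\<close> of \<open>p\<close> do not
  change the maximum modulus set, so let \<open>p 0 \<noteq> 0\<close>; if \<open>p\<close> is constant the set is the plane.
  Otherwise \<open>|p (r w)|\<^sup>2\<close> is, on the unit circle, a Laurent polynomial in \<open>w\<close> whose coefficients are
  polynomials in \<open>r\<close>. Its angular derivative vanishes at a maximum, so every point of the maximum
  modulus set lies over a root \<open>w\<close> of a polynomial \<open>critical_poly p r\<close>, whose degree does not depend
  on \<open>r\<close>. Following these roots, off the circle as well, replaces any appeal to semialgebraic
  geometry.

  The algebraic half of the argument is \<open>generic_number_of_critical_values\<close>: the number of distinct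
  critical points, and the number of distinct values of the squared modulus at them, are constant
  except for finitely many \<open>r\<close>. The reason is that the event ``there are at least \<open>K\<close> distinct
  values'' is detected, for the largest \<open>K\<close> that occurs, by a symmetric function of the roots. By
  Newton's identities such functions are Laurent polynomials in \<open>r\<close>, and a nonzero Laurent
  polynomial has only finitely many zeros.

  The topological half is \<open>peaks_along_sections\<close>: near a radius where both numbers are locally
  constant the critical points are continuous functions of \<open>r\<close>. They cannot merge or split, which
  also prevents them from entering or leaving the unit circle, since the critical points are symmetric
  under inversion in it. Values that agree at one radius agree at all nearby ones, as otherwise the
  number of values would go up. Hence a critical point that attains the maximum continues to do so,
  and the maximum modulus set consists locally of arcs, each meeting every nearby circle exactly once.

  Consequently the set of moduli of a component \<open>\<Gamma>\<close> is relatively open and closed in each interval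
  free of exceptional radii: if \<open>\<Gamma>\<close> meets one circle of such an interval, it meets them all
  (\<open>component_covers_interval\<close>). Take the circles with exceptional radius and one more circle in
  each interval between those. Every component meets the maximum modulus set on one of these finitely
  many circles, and each of them carries only finitely many points of that set.
\<close>

section \<open>Functions given by a Laurent polynomial in a positive radius\<close>

text \<open>Nothing is said about \<open>r \<le> 0\<close>; radii are positive, and quotients by powers of \<open>r\<close> have to be
  available.\<close>

definition laurent_on_pos :: "(real \<Rightarrow> complex) \<Rightarrow> bool" where
  "laurent_on_pos f \<longleftrightarrow> (\<exists>q N. \<forall>r>0. f r = poly q (of_real r) / of_real r ^ N)"

lemma laurent_on_pos_cong:
  assumes "laurent_on_pos f" "\<And>r. r > 0 \<Longrightarrow> g r = f r"
  shows "laurent_on_pos g"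
  using assms unfolding laurent_on_pos_def by metis

lemma laurent_on_pos_monomial: "laurent_on_pos (\<lambda>r. c * of_real r ^ k)"
  unfolding laurent_on_pos_def
  by (rule exI[of _ "monom c k"], rule exI[of _ 0]) (simp add: poly_monom)

lemma laurent_on_pos_const: "laurent_on_pos (\<lambda>r. c)"
  using laurent_on_pos_monomial[of c 0] by simp

lemma laurent_on_pos_inverse_monomial: "laurent_on_pos (\<lambda>r. inverse (c * of_real r ^ k))"
  unfolding laurent_on_pos_def
  by (rule exI[of _ "[:inverse c:]"], rule exI[of _ k]) (simp add: field_simps)

lemma laurent_on_pos_mult:
  assumes "laurent_on_pos f" "laurent_on_pos g"
  shows "laurent_on_pos (\<lambda>r. f r * g r)"
proof -
  obtain p N q K where
    "\<forall>r>0. f r = poly p (of_real r) / of_real r ^ N" "\<forall>r>0. g r = poly q (of_real r) / of_real r ^ K"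
    using assms unfolding laurent_on_pos_def by metis
  then have "\<forall>r>0. f r * g r = poly (p * q) (of_real r) / of_real r ^ (N + K)"
    by (simp add: power_add)
  then show ?thesis unfolding laurent_on_pos_def by blast
qed

lemma laurent_on_pos_add:
  assumes "laurent_on_pos f" "laurent_on_pos g"
  shows "laurent_on_pos (\<lambda>r. f r + g r)"
proof -
  obtain p N q K where
    "\<forall>r>0. f r = poly p (of_real r) / of_real r ^ N" "\<forall>r>0. g r = poly q (of_real r) / of_real r ^ K"
    using assms unfolding laurent_on_pos_def by metis
  then have "\<forall>r>0. f r + g r = poly (p * monom 1 K + q * monom 1 N) (of_real r) / of_real r ^ (N + K)"
    by (simp add: power_add poly_monom field_simps)
  then show ?thesis unfolding laurent_on_pos_def by blast
qed

lemma laurent_on_pos_sum: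
  assumes "\<And>i. i \<in> I \<Longrightarrow> laurent_on_pos (f i)"
  shows "laurent_on_pos (\<lambda>r. \<Sum>i\<in>I. f i r)"
  using assms
  by (induction I rule: infinite_finite_induct) (auto intro: laurent_on_pos_add laurent_on_pos_const)

lemma laurent_on_pos_prod:
  assumes "\<And>i. i \<in> I \<Longrightarrow> laurent_on_pos (f i)"
  shows "laurent_on_pos (\<lambda>r. \<Prod>i\<in>I. f i r)"
  using assms
  by (induction I rule: infinite_finite_induct) (auto intro: laurent_on_pos_mult laurent_on_pos_const)

lemma finite_zeros_laurent_on_pos:
  assumes "laurent_on_pos f" "s > 0" "f s \<noteq> 0"
  shows "finite {r. r > 0 \<and> f r = 0}"
proof -
  obtain q N where q: "\<And>r. r > 0 \<Longrightarrow> f r = poly q (of_real r) / of_real r ^ N"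
    using assms(1) unfolding laurent_on_pos_def by metis
  have "q \<noteq> 0" using q[OF assms(2)] assms(3) by auto
  then have "finite (complex_of_real -` {z. poly q z = 0})"
    by (intro finite_vimageI poly_roots_finite) (auto intro: injI)
  then show ?thesis by (rule finite_subset[rotated]) (auto simp: q)
qed

section \<open>Power sums of the roots\<close>

lemma smult_sum_right: "smult c (\<Sum>i\<in>A. f i) = (\<Sum>i\<in>A. smult c (f i))"
  by (induction A rule: infinite_finite_induct) (simp_all add: smult_add_right)

text \<open>Compare coefficients in \<open>Q' = - (\<Sum>i. u\<^sub>i H\<^sub>i)\<close>, where \<open>H\<^sub>i\<close> is \<open>Q\<close> without its \<open>i\<close>-th factor; the
  coefficients of \<open>H\<^sub>i = Q / (1 - u\<^sub>i x)\<close> are those of \<open>Q\<close> convolved with the powers of \<open>u\<^sub>i\<close>. If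
  \<open>c \<noteq> 0\<close>, the nonzero \<open>u\<^sub>i\<close> are the inverses of the roots of \<open>Q\<close>.\<close>

lemma newton_identity:
  fixes u :: "nat \<Rightarrow> complex"
  assumes Q: "Q = smult c (\<Prod>i<n. [:1, - u i:])"
  shows "of_nat (Suc m) * coeff Q (Suc m) = - (\<Sum>l\<le>m. coeff Q l * (\<Sum>i<n. u i ^ (Suc m - l)))"
proof -
  define H where "H i = smult c (\<Prod>j\<in>{..<n} - {i}. [:1, - u j:])" for i
  have QH: "Q = [:1, - u i:] * H i" if "i < n" for i
    using that unfolding Q H_def by (subst prod.remove[of _ i]) (auto simp: mult_ac)
  have cH: "coeff (H i) m = (\<Sum>l\<le>m. coeff Q l * u i ^ (m - l))" if "i < n" for i m
  proof (induction m)
    case 0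
    then show ?case using QH[OF that] by simp
  next
    case (Suc m)
    have "coeff Q (Suc m) = coeff (H i) (Suc m) - u i * coeff (H i) m"
      by (subst QH[OF that]) simp
    then have "coeff (H i) (Suc m) = coeff Q (Suc m) + u i * (\<Sum>l\<le>m. coeff Q l * u i ^ (m - l))"
      using Suc by simp
    also have "u i * (\<Sum>l\<le>m. coeff Q l * u i ^ (m - l)) = (\<Sum>l\<le>m. coeff Q l * u i ^ (Suc m - l))"
      unfolding sum_distrib_left by (intro sum.cong) (auto simp: Suc_diff_le)
    finally show ?case by simp
  qed
  have "pderiv Q = (\<Sum>i<n. smult (- u i) (H i))"
    unfolding Q H_def pderiv_smult pderiv_prod smult_sum_right
    by (intro sum.cong refl) (simp add: pderiv_pCons mult.commute)
  then have "of_nat (Suc m) * coeff Q (Suc m) = (\<Sum>i<n. - u i * coeff (H i) m)"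
    by (metis (no_types, lifting) coeff_pderiv coeff_sum coeff_smult sum.cong)
  also have "\<dots> = (\<Sum>i<n. \<Sum>l\<le>m. - (coeff Q l * u i ^ (Suc m - l)))"
    by (intro sum.cong) (auto simp: cH sum_distrib_left Suc_diff_le sum_negf mult_ac)
  also have "\<dots> = - (\<Sum>l\<le>m. coeff Q l * (\<Sum>i<n. u i ^ (Suc m - l)))"
    by (subst sum.swap) (simp add: sum_distrib_left sum_negf)
  finally show ?thesis .
qed

text \<open>Newton's identity determines each power sum recursively. The only division is by the constant
  coefficient of \<open>Q\<close>; it keeps the result Laurent because that coefficient is a monomial in \<open>r\<close>.\<close>

lemma laurent_on_pos_power_sum:
  fixes u :: "real \<Rightarrow> nat \<Rightarrow> complex"
  assumes fact: "\<And>r. r > 0 \<Longrightarrow> Q r = smult (c r) (\<Prod>i<n. [:1, - u r i:])"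
    and coeffs: "\<And>m. laurent_on_pos (\<lambda>r. coeff (Q r) m)"
    and const: "\<And>r. r > 0 \<Longrightarrow> coeff (Q r) 0 = a * of_real r ^ N" and "a \<noteq> 0"
  shows "laurent_on_pos (\<lambda>r. \<Sum>i<n. u r i ^ m)"
proof (induction m rule: less_induct)
  case (less m)
  show ?case
  proof (cases m)
    case 0
    then show ?thesis by (simp add: laurent_on_pos_const)
  next
    case (Suc k)
    let ?P = "\<lambda>m r. \<Sum>i<n. u r i ^ m"
    let ?g = "\<lambda>r. inverse (a * of_real r ^ N) *
      ((- of_nat m) * coeff (Q r) m + (- 1) * (\<Sum>l\<in>{1..k}. coeff (Q r) l * ?P (m - l) r))"
    have "laurent_on_pos ?g"
      by (intro laurent_on_pos_mult laurent_on_pos_inverse_monomial laurent_on_pos_add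
          laurent_on_pos_const coeffs laurent_on_pos_sum less) (use Suc in auto)
    moreover have "?P m r = ?g r" if "r > 0" for r
    proof -
      have "of_nat m * coeff (Q r) m = - (\<Sum>l\<le>k. coeff (Q r) l * ?P (m - l) r)"
        using newton_identity[OF fact[OF that], of k] Suc by simp
      also have "{..k} = insert 0 {1..k}" by auto
      finally have "of_nat m * coeff (Q r) m =
          - (a * of_real r ^ N * ?P m r + (\<Sum>l\<in>{1..k}. coeff (Q r) l * ?P (m - l) r))"
        using const[OF that] by simp
      then have "a * of_real r ^ N * ?P m r =
          (- of_nat m) * coeff (Q r) m + (- 1) * (\<Sum>l\<in>{1..k}. coeff (Q r) l * ?P (m - l) r)"
        unfolding mult_minus_left by simp
      moreover have "a * of_real r ^ N \<noteq> 0" using that \<open>a \<noteq> 0\<close> by simp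
      ultimately show ?thesis by (metis (no_types, lifting) mult.assoc left_inverse mult_1)
    qed
    ultimately show ?thesis by (rule laurent_on_pos_cong)
  qed
qed


section \<open>The number of values at the roots is generically constant\<close>

text \<open>Laurent polynomials in \<open>y 0, \<dots>, y (k - 1)\<close> over the ring of Laurent polynomials in \<open>r\<close>. Positive
  and negative powers are kept apart, so that the product of two monomials is a monomial also where
  a coordinate vanishes.\<close>

inductive tuple_laurent :: "nat \<Rightarrow> (real \<Rightarrow> (nat \<Rightarrow> complex) \<Rightarrow> complex) \<Rightarrow> bool" for k where
  monomial: "laurent_on_pos a \<Longrightarrow>
    tuple_laurent k (\<lambda>r y. a r * (\<Prod>i<k. y i ^ e i * inverse (y i) ^ f i))"
| add: "tuple_laurent k \<Phi> \<Longrightarrow> tuple_laurent k \<Psi> \<Longrightarrow> tuple_laurent k (\<lambda>r y. \<Phi> r y + \<Psi> r y)"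

lemma tuple_laurent_coeff: "laurent_on_pos a \<Longrightarrow> tuple_laurent k (\<lambda>r y. a r)"
  using tuple_laurent.monomial[of a k "\<lambda>_. 0" "\<lambda>_. 0"] by simp

lemma tuple_laurent_coordinate: "i < k \<Longrightarrow> tuple_laurent k (\<lambda>r y. y i)"
  using tuple_laurent.monomial[OF laurent_on_pos_const, of k 1 "\<lambda>j. if j = i then 1 else 0" "\<lambda>_. 0"]
  by (simp add: if_distrib[of "power _"] cong: if_cong)

lemma tuple_laurent_inverse_coordinate: "i < k \<Longrightarrow> tuple_laurent k (\<lambda>r y. inverse (y i))"
  using tuple_laurent.monomial[OF laurent_on_pos_const, of k 1 "\<lambda>_. 0" "\<lambda>j. if j = i then 1 else 0"]
  by (simp add: if_distrib[of "power _"] cong: if_cong)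

lemma tuple_laurent_mult:
  assumes "tuple_laurent k \<Phi>" "tuple_laurent k \<Psi>"
  shows "tuple_laurent k (\<lambda>r y. \<Phi> r y * \<Psi> r y)"
  using assms(1)
proof induction
  case (monomial a e f)
  show ?case
    using assms(2)
  proof induction
    case (monomial b e' f')
    have "tuple_laurent k (\<lambda>r y. (a r * b r) *
        (\<Prod>i<k. y i ^ (e i + e' i) * inverse (y i) ^ (f i + f' i)))"
      by (intro tuple_laurent.monomial laurent_on_pos_mult \<open>laurent_on_pos a\<close> monomial)
    then show ?case
      by (simp add: power_add prod.distrib mult_ac)
  next
    case (add \<Phi> \<Psi>)
    then show ?case
      using tuple_laurent.add by (simp add: distrib_left)
  qed
next
  case (add \<Phi> \<Psi>)
  then show ?case
    using tuple_laurent.add by (simp add: distrib_right)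
qed

lemma tuple_laurent_diff:
  assumes "tuple_laurent k \<Phi>" "tuple_laurent k \<Psi>"
  shows "tuple_laurent k (\<lambda>r y. \<Phi> r y - \<Psi> r y)"
  using tuple_laurent.add[OF assms(1)
      tuple_laurent_mult[OF tuple_laurent_coeff[OF laurent_on_pos_const[of "-1"]] assms(2)]]
  by simp

lemma tuple_laurent_sum:
  assumes "\<And>i. i \<in> I \<Longrightarrow> tuple_laurent k (\<Phi> i)"
  shows "tuple_laurent k (\<lambda>r y. \<Sum>i\<in>I. \<Phi> i r y)"
  using assms
  by (induction I rule: infinite_finite_induct)
    (auto intro: tuple_laurent.add tuple_laurent_coeff laurent_on_pos_const)

lemma tuple_laurent_prod:
  assumes "\<And>i. i \<in> I \<Longrightarrow> tuple_laurent k (\<Phi> i)"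
  shows "tuple_laurent k (\<lambda>r y. \<Prod>i\<in>I. \<Phi> i r y)"
  using assms
  by (induction I rule: infinite_finite_induct)
    (auto intro: tuple_laurent_mult tuple_laurent_coeff laurent_on_pos_const)

lemma tuple_laurent_power:
  assumes "tuple_laurent k \<Phi>"
  shows "tuple_laurent k (\<lambda>r y. \<Phi> r y ^ m)"
  using tuple_laurent_prod[of "{..<m}" k "\<lambda>_. \<Phi>"] assms by simp

text \<open>Summing over all \<open>k\<close>-tuples of roots turns a monomial into a product of \<open>k\<close> power sums. This is how
  symmetric functions of the roots are seen to be Laurent polynomials in \<open>r\<close>.\<close>

lemma laurent_on_pos_sum_tuples:
  fixes x :: "real \<Rightarrow> nat \<Rightarrow> complex"
  assumes "tuple_laurent k \<Phi>"
    and nz: "\<And>r i. r > 0 \<Longrightarrow> i < n \<Longrightarrow> x r i \<noteq> 0"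
    and pos: "\<And>m. laurent_on_pos (\<lambda>r. \<Sum>i<n. x r i ^ m)"
    and neg: "\<And>m. laurent_on_pos (\<lambda>r. \<Sum>i<n. inverse (x r i) ^ m)"
  shows "laurent_on_pos (\<lambda>r. \<Sum>t\<in>PiE {..<k} (\<lambda>_. {..<n}). \<Phi> r (\<lambda>i. x r (t i)))"
  using assms(1)
proof induction
  case (monomial a e f)
  have mixed: "laurent_on_pos (\<lambda>r. \<Sum>j<n. x r j ^ e * inverse (x r j) ^ f)" for e f
  proof (cases "f \<le> e")
    case True
    show ?thesis
    proof (rule laurent_on_pos_cong[OF pos[of "e - f"]], intro sum.cong refl)
      fix r j assume "r > (0::real)" "j \<in> {..<n}"
      then show "x r j ^ e * inverse (x r j) ^ f = x r j ^ (e - f)"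
        using nz[of r j] True by (simp add: power_diff power_inverse divide_inverse)
    qed
  next
    case False
    show ?thesis
    proof (rule laurent_on_pos_cong[OF neg[of "f - e"]], intro sum.cong refl)
      fix r j assume "r > (0::real)" "j \<in> {..<n}"
      then show "x r j ^ e * inverse (x r j) ^ f = inverse (x r j) ^ (f - e)"
        using nz[of r j] False by (simp add: power_diff field_simps)
    qed
  qed
  have "(\<Sum>t\<in>PiE {..<k} (\<lambda>_. {..<n}). a r * (\<Prod>i<k. x r (t i) ^ e i * inverse (x r (t i)) ^ f i)) =
      a r * (\<Prod>i<k. \<Sum>j<n. x r j ^ e i * inverse (x r j) ^ f i)" for r
    by (simp add: prod_sum_PiE sum_distrib_left)
  then show ?case
    by (simp only:) (intro laurent_on_pos_mult laurent_on_pos_prod monomial mixed)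
next
  case (add \<Phi> \<Psi>)
  then show ?case
    by (simp only: sum.distrib) (rule laurent_on_pos_add)
qed

text \<open>A tuple with a repeated value contributes \<open>0\<close>. If there are exactly \<open>K\<close> values, every other tuple
  runs through all of them once and contributes the same nonzero number: the product over ordered
  pairs, which up to sign is the discriminant, does not depend on the enumeration. So nothing cancels.\<close>

lemma sum_difference_products_nonzero_iff:
  fixes v :: "nat \<Rightarrow> complex"
  assumes le: "card (v ` {..<n}) \<le> K"
  shows "(\<Sum>t\<in>PiE {..<K} (\<lambda>_. {..<n}). \<Prod>i<K. \<Prod>j\<in>{..<K} - {i}. v (t i) - v (t j)) \<noteq> 0
    \<longleftrightarrow> card (v ` {..<n}) = K"
proof -
  define Y where "Y = v ` {..<n}"
  define T where "T = PiE {..<K} (\<lambda>_. {..<n})"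
  define D where "D t = (\<Prod>i<K. \<Prod>j\<in>{..<K} - {i}. v (t i) - v (t j))" for t
  have T: "finite T" unfolding T_def by (intro finite_PiE) auto
  have fY: "finite Y" unfolding Y_def by simp
  have YD: "(\<lambda>i. v (t i)) ` {..<K} \<subseteq> Y" if "t \<in> T" for t
    using that unfolding T_def Y_def by auto
  have D0: "D t = 0" if noninj: "\<not> inj_on (\<lambda>i. v (t i)) {..<K}" for t
  proof -
    obtain i j where ij: "i < K" "j < K" "i \<noteq> j" "v (t i) = v (t j)"
      using noninj unfolding inj_on_def by blast
    then have "(\<Prod>j\<in>{..<K} - {i}. v (t i) - v (t j)) = 0"
      by (intro prod_zero) (use ij in auto)
    with ij(1) show ?thesis unfolding D_def by (intro prod_zero) auto
  qed
  have imgY: "(\<lambda>i. v (t i)) ` {..<K} = Y" if "t \<in> T" "inj_on (\<lambda>i. v (t i)) {..<K}" for t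
    using YD[OF that(1)] le fY card_image[OF that(2)] unfolding Y_def[symmetric]
    by (intro card_seteq) auto
  show ?thesis
    unfolding T_def[symmetric] D_def[symmetric] Y_def[symmetric]
  proof
    assume "(\<Sum>t\<in>T. D t) \<noteq> 0"
    then obtain t where "t \<in> T" "D t \<noteq> 0" by (meson sum.not_neutral_contains_not_neutral)
    then have "inj_on (\<lambda>i. v (t i)) {..<K}" using D0 by blast
    then show "card Y = K"
      using imgY[OF \<open>t \<in> T\<close>] card_image by fastforce
  next
    assume K: "card Y = K"
    define \<Delta> where "\<Delta> = (\<Prod>a\<in>Y. \<Prod>b\<in>Y - {a}. a - b)"
    have D1: "D t = \<Delta>" if "t \<in> T" "inj_on (\<lambda>i. v (t i)) {..<K}" for t
    proof -
      have "\<Delta> = (\<Prod>i<K. \<Prod>b\<in>Y - {v (t i)}. v (t i) - b)"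
        unfolding \<Delta>_def imgY[OF that, symmetric] by (subst prod.reindex[OF that(2)]) simp
      also have "\<dots> = D t"
        unfolding D_def
      proof (intro prod.cong refl)
        fix i assume i: "i \<in> {..<K}"
        have "Y - {v (t i)} = (\<lambda>j. v (t j)) ` ({..<K} - {i})"
          unfolding imgY[OF that, symmetric] using inj_on_image_set_diff[OF that(2), of "{..<K}" "{i}"] i
          by simp
        then show "(\<Prod>b\<in>Y - {v (t i)}. v (t i) - b) = (\<Prod>j\<in>{..<K} - {i}. v (t i) - v (t j))"
          by (simp add: prod.reindex inj_on_diff that(2))
      qed
      finally show ?thesis by simp
    qed
    let ?I = "{t \<in> T. inj_on (\<lambda>i. v (t i)) {..<K}}"
    have "(\<Sum>t\<in>T. D t) = (\<Sum>t\<in>?I. D t)"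
      by (rule sum.mono_neutral_right) (use T D0 in auto)
    also have "\<dots> = of_nat (card ?I) * \<Delta>"
      using D1 by simp
    finally have eq: "(\<Sum>t\<in>T. D t) = of_nat (card ?I) * \<Delta>" .
    \<comment> \<open>At least one tuple contributes: choose an index for each of the values.\<close>
    obtain h where h: "bij_betw h {..<K} Y"
      using ex_bij_betw_nat_finite[OF fY] K by (auto simp: atLeast0LessThan)
    define t where "t = restrict (\<lambda>i. inv_into {..<n} v (h i)) {..<K}"
    have vt: "v (t i) = h i" "t i < n" if "i < K" for i
      using bij_betwE[OF h] that inv_into_into[of "h i" v "{..<n}"]
      by (auto simp: t_def Y_def f_inv_into_f)
    have "inj_on (\<lambda>i. v (t i)) {..<K}"
      using bij_betw_imp_inj_on[OF h] vt by (auto simp: inj_on_def)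
    moreover have "t \<in> T" unfolding T_def using vt(2) by (auto simp: t_def)
    ultimately have "card ?I \<noteq> 0" using T by auto
    moreover have "\<Delta> \<noteq> 0" unfolding \<Delta>_def using fY by auto
    ultimately show "(\<Sum>t\<in>T. D t) \<noteq> 0" unfolding eq by simp
  qed
qed

text \<open>Take for \<open>K\<close> the largest number of values that occurs. The discriminant-like sum for \<open>K\<close> is then
  nonzero precisely at the radii with \<open>K\<close> values, and it is a Laurent polynomial in \<open>r\<close>.\<close>

lemma generically_constant_number_of_values:
  fixes x :: "real \<Rightarrow> nat \<Rightarrow> complex" and G :: "real \<Rightarrow> complex \<Rightarrow> complex"
  assumes nz: "\<And>r i. r > 0 \<Longrightarrow> i < n \<Longrightarrow> x r i \<noteq> 0"
    and pos: "\<And>m. laurent_on_pos (\<lambda>r. \<Sum>i<n. x r i ^ m)"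
    and neg: "\<And>m. laurent_on_pos (\<lambda>r. \<Sum>i<n. inverse (x r i) ^ m)"
    and G: "\<And>k i. i < k \<Longrightarrow> tuple_laurent k (\<lambda>r y. G r (y i))"
  shows "\<exists>K. finite {r. r > 0 \<and> card (G r ` x r ` {..<n}) \<noteq> K}"
proof -
  define N where "N r = card ((\<lambda>i. G r (x r i)) ` {..<n})" for r
  define K where "K = Max (N ` {0<..})"
  have "N r \<le> n" for r
    unfolding N_def using card_image_le[of "{..<n}"] by simp
  then have "N ` {0<..} \<subseteq> {..n}"
    by blast
  then have fin: "finite (N ` {0<..})"
    by (rule finite_subset) simp
  have le: "N r \<le> K" if "r > 0" for r
    unfolding K_def using fin that by (intro Max_ge) auto
  have "(1::real) \<in> {0<..}" by simp
  then have "K \<in> N ` {0<..}"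
    unfolding K_def by (intro Max_in fin) blast
  then obtain s where s: "s > 0" "N s = K" by auto
  define E where "E r = (\<Sum>t\<in>PiE {..<K} (\<lambda>_. {..<n}).
      \<Prod>i<K. \<Prod>j\<in>{..<K} - {i}. G r (x r (t i)) - G r (x r (t j)))" for r
  have E: "E r \<noteq> 0 \<longleftrightarrow> N r = K" if "r > 0" for r
    unfolding E_def N_def
    by (rule sum_difference_products_nonzero_iff) (use le[OF that] in \<open>simp add: N_def\<close>)
  have "laurent_on_pos E"
    unfolding E_def
    by (rule laurent_on_pos_sum_tuples[where \<Phi> = "\<lambda>r y. \<Prod>i<K. \<Prod>j\<in>{..<K} - {i}. G r (y i) - G r (y j)", OF _ nz pos neg])
      (auto intro!: tuple_laurent_prod tuple_laurent_diff G)
  then have "finite {r. r > 0 \<and> E r = 0}"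
    using finite_zeros_laurent_on_pos s E by blast
  moreover have "{r. r > 0 \<and> E r = 0} = {r. r > 0 \<and> card (G r ` x r ` {..<n}) \<noteq> K}"
    using E by (auto simp: N_def image_image)
  ultimately show ?thesis by auto
qed

section \<open>Continuous selections and their peaks\<close>

text \<open>Around each of the \<open>K\<close> points of \<open>R r0\<close> put a ball, so small that these are disjoint. By lower
  hemicontinuity \<open>R r\<close> meets each of them for \<open>r\<close> near \<open>r0\<close>, hence exactly once, as it has only \<open>K\<close>
  points. The point in a given ball depends continuously on \<open>r\<close>, again by lower hemicontinuity.\<close>

lemma local_sections:
  fixes R :: "real \<Rightarrow> complex set"
  assumes card: "\<forall>\<^sub>F r in nhds r0. finite (R r) \<and> card (R r) = K"
    and lhc: "\<forall>\<^sub>F r in nhds r0. \<forall>y\<in>R r. \<forall>e>0. \<forall>\<^sub>F r' in nhds r. \<exists>x\<in>R r'. dist x y < e"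
  obtains \<delta> s where "\<delta> > 0"
    "\<And>y. y \<in> R r0 \<Longrightarrow> s y r0 = y"
    "\<And>y. y \<in> R r0 \<Longrightarrow> continuous_on (ball r0 \<delta>) (s y)"
    "\<And>r. r \<in> ball r0 \<delta> \<Longrightarrow> bij_betw (\<lambda>y. s y r) (R r0) (R r)"
proof -
  have fin: "finite (R r0)" "card (R r0) = K"
    using eventually_nhds_x_imp_x[OF card] by auto
  obtain \<epsilon> where \<epsilon>: "\<epsilon> > 0" "\<And>y y'. y \<in> R r0 \<Longrightarrow> y' \<in> R r0 \<Longrightarrow> dist y y' < 2 * \<epsilon> \<Longrightarrow> y = y'"
  proof -
    have "\<exists>e>0. \<forall>y\<in>R r0. \<forall>y'\<in>R r0. dist y y' < e \<longrightarrow> y = y'"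
      using uniform_discrete_finite_iff fin(1) unfolding uniform_discrete_def by blast
    then obtain e where "e > 0" "\<forall>y\<in>R r0. \<forall>y'\<in>R r0. dist y y' < e \<longrightarrow> y = y'" by blast
    then show thesis by (intro that[of "e / 2"]) auto
  qed
  have lhc0: "\<forall>\<^sub>F r in nhds r0. \<exists>x\<in>R r. dist x y < \<epsilon>" if "y \<in> R r0" for y
    using eventually_nhds_x_imp_x[OF lhc] that \<epsilon>(1) by blast
  have "\<forall>\<^sub>F r in nhds r0. \<forall>y\<in>R r0. \<exists>x\<in>R r. dist x y < \<epsilon>"
    using fin(1) lhc0 by (intro eventually_ball_finite) auto
  with card lhc have "\<forall>\<^sub>F r in nhds r0. (finite (R r) \<and> card (R r) = K) \<and>
      (\<forall>y\<in>R r. \<forall>e>0. \<forall>\<^sub>F r' in nhds r. \<exists>x\<in>R r'. dist x y < e) \<and>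
      (\<forall>y\<in>R r0. \<exists>x\<in>R r. dist x y < \<epsilon>)"
    by eventually_elim blast
  then obtain \<delta> where \<delta>: "\<delta> > 0" and near: "\<And>r. r \<in> ball r0 \<delta> \<Longrightarrow>
      (finite (R r) \<and> card (R r) = K) \<and>
      (\<forall>y\<in>R r. \<forall>e>0. \<forall>\<^sub>F r' in nhds r. \<exists>x\<in>R r'. dist x y < e) \<and>
      (\<forall>y\<in>R r0. \<exists>x\<in>R r. dist x y < \<epsilon>)"
    unfolding eventually_nhds_metric by (metis dist_commute mem_ball)
  define s where "s y r = (SOME x. x \<in> R r \<and> dist x y < \<epsilon>)" for y r
  have s: "s y r \<in> R r" "dist (s y r) y < \<epsilon>" if "y \<in> R r0" "r \<in> ball r0 \<delta>" for y r
  proof -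
    have "\<exists>x. x \<in> R r \<and> dist x y < \<epsilon>" using near[OF that(2)] that(1) by blast
    from someI_ex[OF this] show "s y r \<in> R r" "dist (s y r) y < \<epsilon>" unfolding s_def by blast+
  qed
  have close: "y = y'" if "y \<in> R r0" "y' \<in> R r0" "dist x y < \<epsilon>" "dist x y' < \<epsilon>" for x y y'
    using \<epsilon>(2)[OF that(1,2)] that(3,4) dist_triangle_half_r[of x y "2 * \<epsilon>" y']
    by (simp add: dist_commute)
  have bij: "bij_betw (\<lambda>y. s y r) (R r0) (R r)" if r: "r \<in> ball r0 \<delta>" for r
  proof -
    have inj: "inj_on (\<lambda>y. s y r) (R r0)"
      using s(2)[OF _ r] close by (intro inj_onI) metis
    moreover have "(\<lambda>y. s y r) ` R r0 = R r"
      using s(1)[OF _ r] near[OF r] fin card_image[OF inj] by (intro card_subset_eq) auto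
    ultimately show ?thesis by (simp add: bij_betw_def)
  qed
  have cont: "continuous_on (ball r0 \<delta>) (s y)" if y: "y \<in> R r0" for y
    unfolding continuous_on_iff
  proof (intro ballI allI impI)
    fix r1 and e :: real assume r1: "r1 \<in> ball r0 \<delta>" and e: "e > 0"
    define e' where "e' = min e (\<epsilon> - dist (s y r1) y)"
    have "e' > 0" using e s(2)[OF y r1] by (simp add: e'_def)
    then have "\<forall>\<^sub>F r in nhds r1. \<exists>x\<in>R r. dist x (s y r1) < e'"
      using near[OF r1] s(1)[OF y r1] by blast
    then obtain d where d: "d > 0" "\<And>r. dist r r1 < d \<Longrightarrow> \<exists>x\<in>R r. dist x (s y r1) < e'"
      unfolding eventually_nhds_metric by blast
    show "\<exists>d>0. \<forall>r\<in>ball r0 \<delta>. dist r r1 < d \<longrightarrow> dist (s y r) (s y r1) < e"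
    proof (intro exI[of _ d] conjI ballI impI d)
      fix r assume r: "r \<in> ball r0 \<delta>" and "dist r r1 < d"
      then obtain x where x: "x \<in> R r" "dist x (s y r1) < e'" using d(2) by blast
      have "dist x y < \<epsilon>"
        using x(2) dist_triangle[of x y "s y r1"] by (simp add: e'_def)
      moreover obtain y' where y': "y' \<in> R r0" "x = s y' r"
        using x(1) bij[OF r] unfolding bij_betw_def by blast
      ultimately have "y' = y"
        using close[OF y'(1) y, of x] s(2)[OF y'(1) r] by simp
      then show "dist (s y r) (s y r1) < e"
        using x(2) y'(2) by (simp add: e'_def)
    qed
  qed
  have "s y r0 = y" if "y \<in> R r0" for y
    using s[OF that, of r0] \<delta> close[OF that, of "s y r0" "s y r0"] \<epsilon>(1) by auto
  then show thesis using that[OF \<delta> _ cont bij] by blast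
qed

lemma inverse_eq_cnj:
  assumes "cmod w = 1"
  shows "inverse w = cnj w"
  using assms by (simp add: inverse_complex_def complex_eq_iff cmod_def)

text \<open>Peaks compete only with the points of \<open>R\<close> on the circle; \<open>R\<close> may have others, at which \<open>f\<close> need
  not be real.\<close>

definition peaks :: "complex set \<Rightarrow> (complex \<Rightarrow> complex) \<Rightarrow> complex set" where
  "peaks R f = {w \<in> R. cmod w = 1 \<and> (\<forall>w'\<in>R. cmod w' = 1 \<longrightarrow> Re (f w') \<le> Re (f w))}"

text \<open>On \<open>A\<close> the function \<open>f\<close> factors through \<open>g\<close>. A surjection between finite sets of equal size is
  injective.\<close>

lemma equal_card_imp_same_fibres:
  assumes "finite A" and refines: "\<And>x y. x \<in> A \<Longrightarrow> y \<in> A \<Longrightarrow> g x = g y \<Longrightarrow> f x = f y"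
    and "card (g ` A) = card (f ` A)" and "x \<in> A" "y \<in> A" "f x = f y"
  shows "g x = g y"
proof -
  define h where "h b = f (SOME a. a \<in> A \<and> g a = b)" for b
  have h: "h (g a) = f a" if "a \<in> A" for a
  proof -
    have "(SOME a'. a' \<in> A \<and> g a' = g a) \<in> A \<and> g (SOME a'. a' \<in> A \<and> g a' = g a) = g a"
      by (rule someI[of "\<lambda>a'. a' \<in> A \<and> g a' = g a" a]) (use that in simp)
    then show ?thesis unfolding h_def using refines that by blast
  qed
  then have "h ` g ` A = f ` A" by (auto simp: image_iff)
  then have "inj_on h (g ` A)"
    using assms(1,3) by (intro eq_card_imp_inj_on) auto
  then show ?thesis
    using assms(4-6) h by (metis imageI inj_onD)
qed

text \<open>Whether a point is a peak is decided by its being on the circle and by the order of the values,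
  and both are shown not to change along the continuous selections. Strict inequalities persist by
  continuity. Equalities persist because the number of values is constant, and a point remains on the
  circle because it would otherwise split into two points exchanged by \<open>x \<mapsto> inverse (cnj x)\<close>.\<close>

lemma peaks_along_sections:
  fixes R :: "real \<Rightarrow> complex set" and F :: "real \<Rightarrow> complex \<Rightarrow> complex"
  assumes card: "\<forall>\<^sub>F r in nhds r0. finite (R r) \<and> card (R r) = K"
    and lhc: "\<forall>\<^sub>F r in nhds r0. \<forall>y\<in>R r. \<forall>e>0. \<forall>\<^sub>F r' in nhds r. \<exists>x\<in>R r'. dist x y < e"
    and vals: "\<forall>\<^sub>F r in nhds r0. card (F r ` R r) = L"
    and refl: "\<forall>\<^sub>F r in nhds r0. \<forall>x\<in>R r. x \<noteq> 0 \<and> inverse (cnj x) \<in> R r"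
    and cont: "\<And>y. y \<in> R r0 \<Longrightarrow> isCont (\<lambda>(r, w). F r w) (r0, y)"
    and real: "\<And>r w. cmod w = 1 \<Longrightarrow> F r w \<in> \<real>"
  obtains \<delta> where "\<delta> > 0"
    "\<And>r w. r \<in> ball r0 \<delta> \<Longrightarrow> w \<in> peaks (R r) (F r) \<Longrightarrow>
       \<exists>s. continuous_on (ball r0 \<delta>) s \<and> s r = w \<and> (\<forall>r'\<in>ball r0 \<delta>. s r' \<in> peaks (R r') (F r'))"
proof -
  have fin: "finite (R r0)"
    using eventually_nhds_x_imp_x[OF card] by auto
  obtain \<delta>1 s where \<delta>1: "\<delta>1 > 0"
    and s0: "\<And>y. y \<in> R r0 \<Longrightarrow> s y r0 = y"
    and scont: "\<And>y. y \<in> R r0 \<Longrightarrow> continuous_on (ball r0 \<delta>1) (s y)"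
    and bij1: "\<And>r. r \<in> ball r0 \<delta>1 \<Longrightarrow> bij_betw (\<lambda>y. s y r) (R r0) (R r)"
    using local_sections[OF card lhc] by metis
  have bij: "\<forall>\<^sub>F r in nhds r0. bij_betw (\<lambda>y. s y r) (R r0) (R r)"
    using eventually_nhds_in_open[of "ball r0 \<delta>1" r0] \<delta>1 bij1
    by (auto elim: eventually_mono)
  have s_lim: "(s y \<longlongrightarrow> y) (nhds r0)" if "y \<in> R r0" for y
  proof -
    have "isCont (s y) r0"
      using scont[OF that] \<delta>1 by (simp add: continuous_on_eq_continuous_at)
    then show ?thesis
      unfolding isCont_def tendsto_at_iff_tendsto_nhds using s0[OF that] by simp
  qed
  have F_lim: "((\<lambda>r. F r (s y r)) \<longlongrightarrow> F r0 y) (nhds r0)" if "y \<in> R r0" for y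
  proof -
    have "((\<lambda>r. (r, s y r)) \<longlongrightarrow> (r0, y)) (nhds r0)"
      by (intro tendsto_Pair s_lim that) (rule filterlim_ident)
    from isCont_tendsto_compose[OF cont[OF that] this] show ?thesis by simp
  qed

  have on_circle: "\<forall>\<^sub>F r in nhds r0. cmod (s y r) = 1 \<longleftrightarrow> cmod y = 1" if y: "y \<in> R r0" for y
  proof (cases "cmod y = 1")
    case False
    have "((\<lambda>r. cmod (s y r)) \<longlongrightarrow> cmod y) (nhds r0)"
      by (intro tendsto_norm s_lim y)
    from tendsto_imp_eventually_ne[OF this False] show ?thesis
      by eventually_elim (use False in auto)
  next
    case True
    then have y0: "y \<noteq> 0" "inverse (cnj y) = y"
      using inverse_eq_cnj[of y] by (auto simp flip: inverse_eq_cnj)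
    have "((\<lambda>r. inverse (cnj (s y r))) \<longlongrightarrow> inverse (cnj y)) (nhds r0)"
      by (intro tendsto_inverse tendsto_cnj s_lim y) (use y0 in simp)
    then have lim: "((\<lambda>r. inverse (cnj (s y r))) \<longlongrightarrow> y) (nhds r0)"
      using y0 by simp
    have "\<forall>\<^sub>F r in nhds r0. inverse (cnj (s y r)) - s y' r \<noteq> 0" if "y' \<in> R r0 - {y}" for y'
      using that by (intro tendsto_imp_eventually_ne[OF tendsto_diff[OF lim s_lim]]) auto
    then have "\<forall>\<^sub>F r in nhds r0. \<forall>y'\<in>R r0 - {y}. inverse (cnj (s y r)) - s y' r \<noteq> 0"
      using fin by (intro eventually_ball_finite) auto
    then show ?thesis
      using bij refl
    proof eventually_elim
      case (elim r)
      have "s y r \<in> R r" using elim(2) y by (auto simp: bij_betw_def)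
      then have "s y r \<noteq> 0" "inverse (cnj (s y r)) \<in> (\<lambda>y. s y r) ` R r0"
        using elim(2,3) by (auto simp: bij_betw_def)
      then have "s y r \<noteq> 0" "inverse (cnj (s y r)) = s y r" using elim(1) by auto
      then have "s y r * cnj (s y r) = 1" by (metis complex_cnj_zero_iff left_inverse)
      then have "cmod (s y r) ^ 2 = 1"
        by (metis complex_norm_square of_real_eq_1_iff)
      then show ?case using True by (simp add: power2_eq_1_iff)
         (metis norm_ge_zero not_one_le_zero neg_0_le_iff_le)
    qed
  qed

  have same_value: "\<forall>\<^sub>F r in nhds r0. \<forall>y\<in>R r0. \<forall>y'\<in>R r0. F r0 y = F r0 y' \<longrightarrow> F r (s y r) = F r (s y' r)"
  proof -
    have "\<forall>\<^sub>F r in nhds r0. F r0 y \<noteq> F r0 y' \<longrightarrow> F r (s y r) \<noteq> F r (s y' r)"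
      if "y \<in> R r0" "y' \<in> R r0" for y y'
    proof (cases "F r0 y = F r0 y'")
      case False
      then have "\<forall>\<^sub>F r in nhds r0. F r (s y r) - F r (s y' r) \<noteq> 0"
        by (intro tendsto_imp_eventually_ne[OF tendsto_diff[OF F_lim F_lim]] that) simp
      then show ?thesis by eventually_elim simp
    qed simp
    then have "\<forall>\<^sub>F r in nhds r0. \<forall>y\<in>R r0. \<forall>y'\<in>R r0. F r0 y \<noteq> F r0 y' \<longrightarrow> F r (s y r) \<noteq> F r (s y' r)"
      using fin by (intro eventually_ball_finite ballI) auto
    then show ?thesis
      using bij vals
    proof eventually_elim
      case (elim r)
      have "(\<lambda>y. F r (s y r)) ` R r0 = F r ` R r"
        using bij_betw_imp_surj_on[OF elim(2)] image_image[of "F r" "\<lambda>y. s y r" "R r0"] by simp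
      moreover have "card (F r0 ` R r0) = L" using eventually_nhds_x_imp_x[OF vals] .
      ultimately have "card ((\<lambda>y. F r (s y r)) ` R r0) = card (F r0 ` R r0)"
        using elim(3) by simp
      then show ?case
        using equal_card_imp_same_fibres[OF fin, of "\<lambda>y. F r (s y r)" "F r0"] elim(1) by blast
    qed
  qed

  have less: "\<forall>\<^sub>F r in nhds r0. \<forall>y\<in>R r0. \<forall>y'\<in>R r0.
      Re (F r0 y) < Re (F r0 y') \<longrightarrow> Re (F r (s y r)) < Re (F r (s y' r))"
  proof -
    have "\<forall>\<^sub>F r in nhds r0. Re (F r0 y) < Re (F r0 y') \<longrightarrow> Re (F r (s y r)) < Re (F r (s y' r))"
      if "y \<in> R r0" "y' \<in> R r0" for y y'
    proof (cases "Re (F r0 y) < Re (F r0 y')")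
      case True
      have "((\<lambda>r. Re (F r (s y' r)) - Re (F r (s y r))) \<longlongrightarrow> Re (F r0 y') - Re (F r0 y)) (nhds r0)"
        by (intro tendsto_diff tendsto_Re F_lim that)
      then have "\<forall>\<^sub>F r in nhds r0. 0 < Re (F r (s y' r)) - Re (F r (s y r))"
        using True by (intro order_tendstoD(1)) auto
      then show ?thesis by eventually_elim simp
    qed simp
    then show ?thesis
      using fin by (intro eventually_ball_finite ballI) auto
  qed

  have "\<forall>\<^sub>F r in nhds r0. \<forall>y\<in>R r0. cmod (s y r) = 1 \<longleftrightarrow> cmod y = 1"
    using fin on_circle by (intro eventually_ball_finite) auto
  then have "\<forall>\<^sub>F r in nhds r0. bij_betw (\<lambda>y. s y r) (R r0) (R r) \<and>
      (\<forall>y\<in>R r0. s y r \<in> peaks (R r) (F r) \<longleftrightarrow> y \<in> peaks (R r0) (F r0))"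
    using bij same_value less
  proof eventually_elim
    case (elim r)
    have order: "Re (F r (s y' r)) \<le> Re (F r (s y r)) \<longleftrightarrow> Re (F r0 y') \<le> Re (F r0 y)"
      if "y \<in> R r0" "y' \<in> R r0" "cmod y = 1" "cmod y' = 1" for y y'
    proof (cases "Re (F r0 y) = Re (F r0 y')")
      case True
      then have "F r0 y = F r0 y'"
        using real that by (metis of_real_Re)
      then have "F r (s y r) = F r (s y' r)" using elim(3) that(1,2) by blast
      with True show ?thesis by (metis order_refl)
    next
      case False
      then consider "Re (F r0 y) < Re (F r0 y')" | "Re (F r0 y') < Re (F r0 y)" by linarith
      then show ?thesis using elim(4) that(1,2) by cases (meson less_le_not_le)+
    qed
    have R: "R r = (\<lambda>y. s y r) ` R r0" using elim(2) by (simp add: bij_betw_def)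
    have "s y r \<in> peaks (R r) (F r) \<longleftrightarrow> y \<in> peaks (R r0) (F r0)" if "y \<in> R r0" for y
      using that elim(1) order unfolding peaks_def R by auto
    then show ?case using elim(2) by blast
  qed
  then obtain \<delta>2 where \<delta>2: "\<delta>2 > 0" and near: "\<And>r. r \<in> ball r0 \<delta>2 \<Longrightarrow>
      bij_betw (\<lambda>y. s y r) (R r0) (R r) \<and>
      (\<forall>y\<in>R r0. s y r \<in> peaks (R r) (F r) \<longleftrightarrow> y \<in> peaks (R r0) (F r0))"
    unfolding eventually_nhds_metric by (metis dist_commute mem_ball)
  show thesis
  proof (rule that[of "min \<delta>1 \<delta>2"])
    show "min \<delta>1 \<delta>2 > 0" using \<delta>1 \<delta>2 by simp
    fix r w assume r: "r \<in> ball r0 (min \<delta>1 \<delta>2)" and w: "w \<in> peaks (R r) (F r)"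
    have "w \<in> R r" using w by (simp add: peaks_def)
    then obtain y where y: "y \<in> R r0" "w = s y r"
      using near[of r] r unfolding bij_betw_def by auto
    show "\<exists>s. continuous_on (ball r0 (min \<delta>1 \<delta>2)) s \<and> s r = w \<and>
        (\<forall>r'\<in>ball r0 (min \<delta>1 \<delta>2). s r' \<in> peaks (R r') (F r'))"
    proof (intro exI[of _ "s y"] conjI ballI)
      show "continuous_on (ball r0 (min \<delta>1 \<delta>2)) (s y)"
        by (rule continuous_on_subset[OF scont[OF y(1)]]) auto
      show "s y r = w" using y(2) by simp
      have "y \<in> peaks (R r0) (F r0)" using near[of r] y w r by auto
      then show "s y r' \<in> peaks (R r') (F r')" if "r' \<in> ball r0 (min \<delta>1 \<delta>2)" for r'
        using near[of r'] y(1) that by auto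
    qed
  qed
qed

section \<open>Critical points on a circle\<close>

text \<open>The Laurent polynomial in \<open>w\<close> that equals \<open>|p (r w)|\<^sup>2\<close> for \<open>|w| = 1\<close>; conjugation of \<open>w\<close> is
  replaced by inversion, so that it makes sense at critical points off the circle.\<close>

definition sq_modulus :: "complex poly \<Rightarrow> real \<Rightarrow> complex \<Rightarrow> complex" where
  "sq_modulus p r w = (\<Sum>j\<le>degree p. \<Sum>k\<le>degree p.
     coeff p j * cnj (coeff p k) * of_real r ^ (j + k) * (w ^ j * inverse w ^ k))"

text \<open>This is \<open>w ^ degree p\<close> times \<open>w \<partial>/\<partial>w\<close> of \<open>sq_modulus p r w\<close>, that is, up to the factor \<open>\<i>\<close>, the
  derivative with respect to the angle. The power of \<open>w\<close> removes the poles at \<open>0\<close>.\<close>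

definition critical_poly :: "complex poly \<Rightarrow> real \<Rightarrow> complex poly" where
  "critical_poly p r = (\<Sum>j\<le>degree p. \<Sum>k\<le>degree p.
     monom ((of_nat j - of_nat k) * coeff p j * cnj (coeff p k) * of_real r ^ (j + k))
       (degree p + j - k))"

definition critical_points :: "complex poly \<Rightarrow> real \<Rightarrow> complex set" where
  "critical_points p r = {w. poly (critical_poly p r) w = 0}"

lemma sq_modulus_on_circle:
  assumes "cmod w = 1"
  shows "sq_modulus p r w = of_real ((cmod (poly p (of_real r * w)))\<^sup>2)"
  unfolding complex_norm_square sq_modulus_def inverse_eq_cnj[OF assms] poly_altdef cnj_sum sum_product
  by (intro sum.cong refl) (simp add: power_add power_mult_distrib mult_ac)

lemma poly_critical_poly:
  assumes "w \<noteq> 0"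
  shows "poly (critical_poly p r) w = w ^ degree p * (\<Sum>j\<le>degree p. \<Sum>k\<le>degree p.
     (of_nat j - of_nat k) * coeff p j * cnj (coeff p k) * of_real r ^ (j + k) * (w ^ j * inverse w ^ k))"
  unfolding critical_poly_def poly_sum poly_monom sum_distrib_left
proof (intro sum.cong refl)
  fix j k assume "k \<in> {..degree p}"
  then have "w ^ (degree p + j - k) = w ^ degree p * (w ^ j * inverse w ^ k)"
    using assms by (simp add: power_diff power_add field_simps)
  then show "(of_nat j - of_nat k) * coeff p j * cnj (coeff p k) * of_real r ^ (j + k) *
        w ^ (degree p + j - k) =
      w ^ degree p * ((of_nat j - of_nat k) * coeff p j * cnj (coeff p k) * of_real r ^ (j + k) *
        (w ^ j * inverse w ^ k))"
    by (simp add: mult_ac)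
qed

text \<open>The function \<open>\<theta> \<mapsto> |p (r w cis \<theta>)|\<^sup>2\<close> has a maximum at \<open>0\<close>, and its derivative there is \<open>\<i>\<close> times
  the critical polynomial at \<open>w\<close>, up to a power of \<open>w\<close>.\<close>

lemma maximum_imp_critical:
  assumes w: "cmod w = 1"
    and max: "\<And>w'. cmod w' = 1 \<Longrightarrow> cmod (poly p (of_real r * w')) \<le> cmod (poly p (of_real r * w))"
  shows "w \<in> critical_points p r"
proof -
  define c where "c j k = coeff p j * cnj (coeff p k) * of_real r ^ (j + k) * (w ^ j * inverse w ^ k)" for j k
  define H where "H \<zeta> = (\<Sum>j\<le>degree p. \<Sum>k\<le>degree p. c j k * exp (\<i> * (of_nat j - of_nat k) * \<zeta>))" for \<zeta>
  define D where "D = (\<Sum>j\<le>degree p. \<Sum>k\<le>degree p. c j k * (\<i> * (of_nat j - of_nat k)))"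
  have H: "H (of_real \<theta>) = of_real ((cmod (poly p (of_real r * (w * cis \<theta>))))\<^sup>2)" for \<theta>
  proof -
    have "exp (\<i> * (of_nat j - of_nat k) * of_real \<theta>) = cis \<theta> ^ j * inverse (cis \<theta>) ^ k" for j k
      by (simp add: cis_conv_exp exp_of_nat_mult[symmetric] exp_minus[symmetric] exp_add[symmetric] algebra_simps)
    then have "H (of_real \<theta>) = sq_modulus p r (w * cis \<theta>)"
      unfolding H_def c_def sq_modulus_def
      by (intro sum.cong refl) (simp add: power_mult_distrib mult_ac)
    also have "cmod (w * cis \<theta>) = 1" using w by (simp add: norm_mult)
    note sq_modulus_on_circle[OF this]
    finally show ?thesis .
  qed
  \<comment> \<open>The real part of D vanishes because of the maximum, the imaginary part since H is real on the real line.\<close>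
  have "(H has_field_derivative D) (at (of_real 0))"
    unfolding H_def D_def by (auto intro!: derivative_eq_intros sum.cong)
  then have "((\<lambda>\<theta>. H (of_real \<theta>)) has_vector_derivative D) (at 0)"
    by (rule has_vector_derivative_real_field)
  then have der: "((\<lambda>\<theta>. complex_of_real ((cmod (poly p (of_real r * (w * cis \<theta>))))\<^sup>2)) has_vector_derivative D) (at 0)"
    unfolding H .
  from bounded_linear.has_vector_derivative[OF bounded_linear_Re der]
  have "((\<lambda>\<theta>. (cmod (poly p (of_real r * (w * cis \<theta>))))\<^sup>2) has_real_derivative Re D) (at 0)"
    by (simp add: has_real_derivative_iff_has_vector_derivative)
  then have "Re D = 0"
    by (rule DERIV_local_max[of _ _ _ 1])
      (use w in \<open>auto intro!: power_mono max simp: norm_mult\<close>)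
  moreover have "((\<lambda>\<theta>. 0) has_vector_derivative Im D) (at (0::real))"
    using bounded_linear.has_vector_derivative[OF bounded_linear_Im der] by simp
  then have "Im D = 0"
    using vector_derivative_unique_at has_vector_derivative_const by blast
  ultimately have "D = 0" by (simp add: complex_eq_iff)
  moreover have "D = \<i> * (\<Sum>j\<le>degree p. \<Sum>k\<le>degree p.
      (of_nat j - of_nat k) * coeff p j * cnj (coeff p k) * of_real r ^ (j + k) *
      (w ^ j * inverse w ^ k))"
    unfolding D_def c_def sum_distrib_left by (intro sum.cong refl) (simp add: mult_ac)
  moreover have "w \<noteq> 0" using w by auto
  ultimately show ?thesis
    unfolding critical_points_def by (simp add: poly_critical_poly)
qed

text \<open>Exchanging the two summation indices shows that the angular derivative at \<open>inverse (cnj w)\<close> is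
  the negative conjugate of the one at \<open>w\<close>.\<close>

lemma critical_points_reflect:
  assumes w: "w \<noteq> 0" "w \<in> critical_points p r"
  shows "inverse (cnj w) \<in> critical_points p r"
proof -
  let ?S = "\<lambda>w. \<Sum>j\<le>degree p. \<Sum>k\<le>degree p.
     (of_nat j - of_nat k) * coeff p j * cnj (coeff p k) * of_real r ^ (j + k) * (w ^ j * inverse w ^ k)"
  have "?S (inverse (cnj w)) = (\<Sum>k\<le>degree p. \<Sum>j\<le>degree p.
     (of_nat j - of_nat k) * coeff p j * cnj (coeff p k) * of_real r ^ (j + k) *
       (inverse (cnj w) ^ j * inverse (inverse (cnj w)) ^ k))"
    by (rule sum.swap)
  also have "\<dots> = - cnj (?S w)"
    unfolding cnj_sum sum_negf[symmetric]
    by (intro sum.cong refl) (simp add: algebra_simps)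
  also have "?S w = 0"
    using w by (simp add: critical_points_def poly_critical_poly)
  finally show ?thesis
    using w(1) by (simp add: critical_points_def poly_critical_poly del: inverse_inverse_eq)
qed

lemma double_sum_single:
  assumes "finite A" "finite B" "a \<in> A" "b \<in> B"
    and "\<And>j k. j \<in> A \<Longrightarrow> k \<in> B \<Longrightarrow> (j, k) \<noteq> (a, b) \<Longrightarrow> f j k = 0"
  shows "(\<Sum>j\<in>A. \<Sum>k\<in>B. f j k) = f a b"
proof -
  have "(\<Sum>j\<in>A. \<Sum>k\<in>B. f j k) = (\<Sum>(j, k)\<in>{(a, b)}. f j k)"
    unfolding sum.cartesian_product
    by (rule sum.mono_neutral_right) (use assms in auto)
  then show ?thesis by simp
qed

lemma coeff_critical_poly:
  "coeff (critical_poly p r) m = (\<Sum>j\<le>degree p. \<Sum>k\<le>degree p.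
     (if degree p + j - k = m then (of_nat j - of_nat k) * coeff p j * cnj (coeff p k) else 0) *
       of_real r ^ (j + k))"
  unfolding critical_poly_def coeff_sum coeff_monom by (intro sum.cong refl) simp

text \<open>The extreme coefficients come from a single index pair each. They are monomials in \<open>r\<close>, which
  fixes the degree for \<open>r > 0\<close> and permits the division in Newton's identities.\<close>

lemma coeff_critical_poly_0:
  "coeff (critical_poly p r) 0 =
     - of_nat (degree p) * coeff p 0 * cnj (lead_coeff p) * of_real r ^ degree p"
  unfolding coeff_critical_poly
  by (subst double_sum_single[where a = 0 and b = "degree p"]) auto

lemma coeff_critical_poly_top:
  "coeff (critical_poly p r) (2 * degree p) =
     of_nat (degree p) * lead_coeff p * cnj (coeff p 0) * of_real r ^ degree p"
  unfolding coeff_critical_poly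
  by (subst double_sum_single[where a = "degree p" and b = 0]) auto

lemma laurent_on_pos_coeff_critical_poly: "laurent_on_pos (\<lambda>r. coeff (critical_poly p r) m)"
  unfolding coeff_critical_poly by (intro laurent_on_pos_sum laurent_on_pos_monomial)

lemma tuple_laurent_sq_modulus:
  "i < k \<Longrightarrow> tuple_laurent k (\<lambda>r y. sq_modulus p r (y i))"
  unfolding sq_modulus_def
  by (intro tuple_laurent_sum tuple_laurent_mult tuple_laurent_coeff laurent_on_pos_monomial
      tuple_laurent_power tuple_laurent_coordinate tuple_laurent_inverse_coordinate)

lemma reflect_poly_linear: "x \<noteq> 0 \<Longrightarrow> reflect_poly [:- x, 1:] = [:1, - (x::complex):]"
  by (rule poly_eqI) (auto simp: coeff_reflect_poly coeff_pCons split: nat.splits)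

section \<open>The maximum modulus set as a set of peaks\<close>

lemma in_max_modulus_set_iff:
  assumes "continuous_on UNIV f"
  shows "z \<in> max_modulus_set f \<longleftrightarrow> (\<forall>u. cmod u = cmod z \<longrightarrow> cmod (f u) \<le> cmod (f z))"
  using max_modulus_upper[OF assms] max_modulus_attained[OF assms norm_ge_zero[of z]]
  unfolding max_modulus_set_def by (smt (verit) mem_Collect_eq)

lemma continuous_on_poly_complex: "continuous_on UNIV (poly (p :: complex poly))"
  by (intro continuous_intros)

lemmas in_max_modulus_set_poly_iff = in_max_modulus_set_iff[OF continuous_on_poly_complex]

lemma finite_components_if_hitting_finite:
  assumes "finite Z" and "\<And>\<Gamma>. \<Gamma> \<in> components S \<Longrightarrow> \<Gamma> \<inter> Z \<noteq> {}"
  shows "finite (components S)"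
proof -
  have "components S \<subseteq> (\<lambda>z. connected_component_set S z) ` Z"
  proof
    fix \<Gamma> assume \<Gamma>: "\<Gamma> \<in> components S"
    then obtain z where "z \<in> \<Gamma>" "z \<in> Z" using assms(2) by blast
    moreover have "\<Gamma> = connected_component_set S z"
      using \<Gamma> \<open>z \<in> \<Gamma>\<close> by (metis componentsE connected_component_eq)
    ultimately show "\<Gamma> \<in> (\<lambda>z. connected_component_set S z) ` Z" by blast
  qed
  then show ?thesis using assms(1) finite_surj by blast
qed

text \<open>The maximum over the whole circle is attained at a critical point, so comparing with the critical
  points on the circle suffices.\<close>

lemma max_modulus_set_iff_peaks:
  assumes r: "r > 0" and w: "cmod w = 1"
  shows "of_real r * w \<in> max_modulus_set (poly p) \<longleftrightarrow>
    w \<in> peaks (critical_points p r) (sq_modulus p r)"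
proof -
  let ?f = "\<lambda>w. cmod (poly p (of_real r * w))"
  have max: "of_real r * w \<in> max_modulus_set (poly p) \<longleftrightarrow> (\<forall>w'. cmod w' = 1 \<longrightarrow> ?f w' \<le> ?f w)"
    if w: "cmod w = 1" for w
  proof
    assume "of_real r * w \<in> max_modulus_set (poly p)"
    then show "\<forall>w'. cmod w' = 1 \<longrightarrow> ?f w' \<le> ?f w"
      using w by (auto simp: in_max_modulus_set_poly_iff norm_mult)
  next
    assume *: "\<forall>w'. cmod w' = 1 \<longrightarrow> ?f w' \<le> ?f w"
    have "cmod (poly p u) \<le> ?f w" if "cmod u = r" for u
      using *[rule_format, of "u / of_real r"] that r by (auto simp: norm_divide)
    then show "of_real r * w \<in> max_modulus_set (poly p)"
      using r w by (auto simp: in_max_modulus_set_poly_iff norm_mult)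
  qed
  have le: "Re (sq_modulus p r w') \<le> Re (sq_modulus p r w) \<longleftrightarrow> ?f w' \<le> ?f w"
    if "cmod w' = 1" "cmod w = 1" for w w'
    using that by (simp add: sq_modulus_on_circle power_mono_iff del: of_real_power)
  show ?thesis
  proof
    assume "of_real r * w \<in> max_modulus_set (poly p)"
    then have *: "\<And>w'. cmod w' = 1 \<Longrightarrow> ?f w' \<le> ?f w" using max w by blast
    then show "w \<in> peaks (critical_points p r) (sq_modulus p r)"
      using maximum_imp_critical[OF w *] w le by (auto simp: peaks_def)
  next
    assume peak: "w \<in> peaks (critical_points p r) (sq_modulus p r)"
    obtain u where u: "cmod u = r" "cmod (poly p u) = max_modulus r (poly p)"
      using max_modulus_attained[OF continuous_on_poly_complex] r by (metis less_imp_le)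
    define v where "v = u / of_real r"
    have v: "cmod v = 1" "of_real r * v = u" using u(1) r by (auto simp: v_def norm_divide)
    have "of_real r * v \<in> max_modulus_set (poly p)"
      using u v by (simp add: max_modulus_set_def)
    then have vmax: "\<And>w'. cmod w' = 1 \<Longrightarrow> ?f w' \<le> ?f v" using max v by blast
    then have "v \<in> critical_points p r" using maximum_imp_critical v(1) by blast
    then have "?f v \<le> ?f w" using peak v(1) w le by (auto simp: peaks_def)
    then show "of_real r * w \<in> max_modulus_set (poly p)"
      using vmax max[OF w] order_trans by blast
  qed
qed

section \<open>Nonconstant polynomials that do not vanish at the origin\<close>

context
  fixes p :: "complex poly"
  assumes deg: "degree p > 0" and c0: "coeff p 0 \<noteq> 0"
begin

lemma degree_critical_poly:
  assumes "r > 0"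
  shows "degree (critical_poly p r) = 2 * degree p"
proof (rule antisym)
  show "degree (critical_poly p r) \<le> 2 * degree p"
    unfolding critical_poly_def
    by (intro degree_sum_le) (auto intro: order_trans[OF degree_monom_le])
  have "p \<noteq> 0" using deg by auto
  then show "2 * degree p \<le> degree (critical_poly p r)"
    using deg c0 assms by (intro le_degree) (simp add: coeff_critical_poly_top)
qed

lemma critical_poly_roots:
  obtains x where
    "\<And>r. r > 0 \<Longrightarrow> critical_poly p r =
       smult (of_nat (degree p) * lead_coeff p * cnj (coeff p 0) * of_real r ^ degree p)
         (\<Prod>i<2 * degree p. [:- x r i, 1:])"
    "\<And>r i. r > 0 \<Longrightarrow> i < 2 * degree p \<Longrightarrow> x r i \<noteq> 0"
    "\<And>r. r > 0 \<Longrightarrow> critical_points p r = x r ` {..<2 * degree p}"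
proof -
  let ?l = "\<lambda>r. of_nat (degree p) * lead_coeff p * cnj (coeff p 0) * of_real r ^ degree p"
  have lc: "lead_coeff (critical_poly p r) = ?l r" if "r > 0" for r
    using degree_critical_poly[OF that] by (simp add: coeff_critical_poly_top)
  have "\<exists>x. critical_poly p r = smult (?l r) (\<Prod>i<2 * degree p. [:- x i, 1:])" if r: "r > 0" for r
  proof -
    obtain x where "smult (lead_coeff (critical_poly p r))
        (\<Prod>i<degree (critical_poly p r). [:- x i, 1:]) = critical_poly p r"
      using complex_poly_decompose' by blast
    then show ?thesis using lc[OF r] degree_critical_poly[OF r] by metis
  qed
  then obtain x where x: "\<And>r. r > 0 \<Longrightarrow>
      critical_poly p r = smult (?l r) (\<Prod>i<2 * degree p. [:- x r i, 1:])"
    by metis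
  have "p \<noteq> 0" using deg by auto
  then have l: "?l r \<noteq> 0" if "r > 0" for r using deg c0 that by simp
  have roots: "critical_points p r = x r ` {..<2 * degree p}" if "r > 0" for r
    unfolding critical_points_def using l[OF that] by (subst x[OF that]) (auto simp: poly_prod)
  have "x r i \<noteq> 0" if r: "r > 0" and i: "i < 2 * degree p" for r i
  proof
    assume "x r i = 0"
    then have "0 \<in> critical_points p r" using roots[OF r] i by (auto simp: image_iff)
    then have "coeff (critical_poly p r) 0 = 0" by (simp add: critical_points_def poly_0_coeff_0)
    then show False
      using deg c0 r \<open>p \<noteq> 0\<close> by (simp add: coeff_critical_poly_0)
  qed
  with x roots show thesis using that by blast
qed

lemma finite_critical_points: "r > 0 \<Longrightarrow> finite (critical_points p r)"
  using critical_poly_roots by (metis finite_imageI finite_lessThan)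

lemma zero_notin_critical_points: "r > 0 \<Longrightarrow> 0 \<notin> critical_points p r"
  using critical_poly_roots by (metis (no_types, lifting) imageE lessThan_iff)

text \<open>Newton's identities concern inverse roots. They give the power sums of the roots when applied to the
  reflected polynomial, and those of the inverse roots when applied to the polynomial itself; both are
  needed since \<open>G\<close> may involve negative powers.\<close>

lemma generic_number_of_critical_values:
  assumes G: "\<And>k i. i < k \<Longrightarrow> tuple_laurent k (\<lambda>r y. G r (y i))"
  shows "\<exists>K. finite {r. r > 0 \<and> card (G r ` critical_points p r) \<noteq> K}"
proof -
  let ?l = "\<lambda>r. of_nat (degree p) * lead_coeff p * cnj (coeff p 0) * of_real r ^ degree p"
  obtain x where x: "\<And>r. r > 0 \<Longrightarrow> critical_poly p r = smult (?l r) (\<Prod>i<2 * degree p. [:- x r i, 1:])"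
    and nz: "\<And>r i. r > 0 \<Longrightarrow> i < 2 * degree p \<Longrightarrow> x r i \<noteq> 0"
    and roots: "\<And>r. r > 0 \<Longrightarrow> critical_points p r = x r ` {..<2 * degree p}"
    using critical_poly_roots by metis
  have "p \<noteq> 0" using deg by auto
  have pos: "laurent_on_pos (\<lambda>r. \<Sum>i<2 * degree p. x r i ^ m)" for m
  proof (rule laurent_on_pos_power_sum)
    show "reflect_poly (critical_poly p r) = smult (?l r) (\<Prod>i<2 * degree p. [:1, - x r i:])"
      if "r > 0" for r
      unfolding x[OF that] reflect_poly_smult reflect_poly_prod
      by (intro arg_cong2[of _ _ _ _ smult] prod.cong refl reflect_poly_linear nz that) auto
    show "laurent_on_pos (\<lambda>r. coeff (reflect_poly (critical_poly p r)) m)" for m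
    proof (rule laurent_on_pos_cong)
      show "laurent_on_pos (\<lambda>r. if 2 * degree p < m then 0
          else coeff (critical_poly p r) (2 * degree p - m))"
        by (cases "2 * degree p < m")
          (simp_all add: laurent_on_pos_const laurent_on_pos_coeff_critical_poly)
    qed (simp add: coeff_reflect_poly degree_critical_poly)
    show "coeff (reflect_poly (critical_poly p r)) 0 =
        (of_nat (degree p) * lead_coeff p * cnj (coeff p 0)) * of_real r ^ degree p" if "r > 0" for r
      using that by (simp add: coeff_reflect_poly degree_critical_poly coeff_critical_poly_top)
    show "of_nat (degree p) * lead_coeff p * cnj (coeff p 0) \<noteq> 0"
      using deg c0 \<open>p \<noteq> 0\<close> by simp
  qed
  have neg: "laurent_on_pos (\<lambda>r. \<Sum>i<2 * degree p. inverse (x r i) ^ m)" for m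
  proof (rule laurent_on_pos_power_sum)
    show "critical_poly p r = smult (?l r * (\<Prod>i<2 * degree p. - x r i))
        (\<Prod>i<2 * degree p. [:1, - inverse (x r i):])" if "r > 0" for r
    proof -
      have "(\<Prod>i<2 * degree p. [:- x r i, 1:]) =
          (\<Prod>i<2 * degree p. smult (- x r i) [:1, - inverse (x r i):])"
        using nz[OF that] by (intro prod.cong refl) simp
      then show ?thesis unfolding x[OF that] prod_smult smult_smult by simp
    qed
    show "coeff (critical_poly p r) 0 =
        (- of_nat (degree p) * coeff p 0 * cnj (lead_coeff p)) * of_real r ^ degree p" for r
      by (rule coeff_critical_poly_0)
    show "- of_nat (degree p) * coeff p 0 * cnj (lead_coeff p) \<noteq> 0"
      using deg c0 \<open>p \<noteq> 0\<close> by simp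
  qed (rule laurent_on_pos_coeff_critical_poly)
  obtain K where "finite {r. r > 0 \<and> card (G r ` x r ` {..<2 * degree p}) \<noteq> K}"
    using generically_constant_number_of_values[OF nz pos neg G] by blast
  also have "{r. r > 0 \<and> card (G r ` x r ` {..<2 * degree p}) \<noteq> K} =
      {r. r > 0 \<and> card (G r ` critical_points p r) \<noteq> K}"
    using roots by auto
  finally show ?thesis by blast
qed

text \<open>At a fixed \<open>y\<close> the critical polynomial has modulus \<open>|l r|\<close> times the product of the distances from
  \<open>y\<close> to its roots, where \<open>l r\<close> is the leading coefficient. If all roots were at distance \<open>\<ge> e\<close>,
  this would be at least \<open>|l r| e ^ (2 degree p)\<close>; but for \<open>r\<close> near \<open>r0\<close> it is smaller, because
  it vanishes at \<open>r0\<close> and \<open>l r0\<close> does not.\<close>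

lemma critical_points_lower_hemicontinuous:
  assumes "r0 > 0" "y \<in> critical_points p r0" "e > 0"
  shows "\<forall>\<^sub>F r in nhds r0. \<exists>x\<in>critical_points p r. dist x y < e"
proof -
  let ?l = "\<lambda>r. of_nat (degree p) * lead_coeff p * cnj (coeff p 0) * of_real r ^ degree p"
  obtain x where x: "\<And>r. r > 0 \<Longrightarrow> critical_poly p r = smult (?l r) (\<Prod>i<2 * degree p. [:- x r i, 1:])"
    and roots: "\<And>r. r > 0 \<Longrightarrow> critical_points p r = x r ` {..<2 * degree p}"
    using critical_poly_roots by metis
  define \<phi> where "\<phi> r = cmod (?l r) * e ^ (2 * degree p) - cmod (poly (critical_poly p r) y)" for r
  have "isCont \<phi> r0"
    unfolding \<phi>_def critical_poly_def poly_sum poly_monom by (intro continuous_intros)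
  then have "(\<phi> \<longlongrightarrow> \<phi> r0) (nhds r0)"
    unfolding isCont_def tendsto_at_iff_tendsto_nhds .
  moreover have "p \<noteq> 0" using deg by auto
  then have "\<phi> r0 > 0"
    using assms deg c0 by (simp add: \<phi>_def critical_points_def)
  ultimately have "\<forall>\<^sub>F r in nhds r0. \<phi> r > 0" by (rule order_tendstoD)
  moreover have "\<forall>\<^sub>F r in nhds r0. r > 0"
    using eventually_nhds_in_open[of "{0<..}" r0] assms(1) by simp
  ultimately show ?thesis
  proof eventually_elim
    case (elim r)
    show ?case
    proof (rule ccontr)
      assume "\<not> ?case"
      then have far: "e \<le> cmod (y - x r i)" if "i < 2 * degree p" for i
        using that roots[OF elim(2)] by (force simp: dist_norm norm_minus_commute not_less)
      have "e ^ (2 * degree p) = (\<Prod>i<2 * degree p. e)" by simp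
      also have "\<dots> \<le> (\<Prod>i<2 * degree p. cmod (y - x r i))"
        using far assms(3) by (intro prod_mono) auto
      finally have "cmod (?l r) * e ^ (2 * degree p) \<le> cmod (?l r) * (\<Prod>i<2 * degree p. cmod (y - x r i))"
        by (intro mult_left_mono) auto
      also have "\<dots> = cmod (poly (critical_poly p r) y)"
        by (subst x[OF elim(2)]) (simp add: poly_prod norm_mult prod_norm[symmetric])
      finally show False using elim(1) by (simp add: \<phi>_def)
    qed
  qed
qed

lemma finite_max_modulus_set_on_circle:
  "finite {z \<in> max_modulus_set (poly p). cmod z = r}"
proof (cases "r > 0")
  case True
  have "{z \<in> max_modulus_set (poly p). cmod z = r} \<subseteq> (\<lambda>w. of_real r * w) ` critical_points p r"
  proof safe
    fix z assume z: "z \<in> max_modulus_set (poly p)" "r = cmod z"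
    define w where "w = z / of_real r"
    have w: "cmod w = 1" "z = of_real r * w" using z True by (auto simp: w_def norm_divide)
    then have "w \<in> critical_points p r"
      using z max_modulus_set_iff_peaks[OF True, of w p] by (simp add: peaks_def)
    then show "z \<in> (\<lambda>w. of_real (cmod z) * w) ` critical_points p (cmod z)"
      unfolding z(2)[symmetric] using w(2) by blast
  qed
  then show ?thesis
    using finite_critical_points[OF True] finite_surj by blast
next
  case False
  then have "{z \<in> max_modulus_set (poly p). cmod z = r} \<subseteq> {0}" by auto
  then show ?thesis using finite_subset by blast
qed

text \<open>Near a radius where both numbers are locally constant, a point of the maximum modulus set lies on the
  arc \<open>r \<mapsto> r * s r\<close> traced out by a peak \<open>s\<close>.\<close>

lemma local_arcs:
  assumes r0: "r0 > 0"
    and card: "\<forall>\<^sub>F r in nhds r0. card (critical_points p r) = K"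
    and vals: "\<forall>\<^sub>F r in nhds r0. card (sq_modulus p r ` critical_points p r) = L"
  obtains \<delta> where "\<delta> > 0"
    "\<And>z. z \<in> max_modulus_set (poly p) \<Longrightarrow> cmod z \<in> ball r0 \<delta> \<Longrightarrow>
       \<exists>C. connected C \<and> C \<subseteq> max_modulus_set (poly p) \<and> z \<in> C \<and> cmod ` C = ball r0 \<delta>"
proof -
  have pos: "\<forall>\<^sub>F r in nhds r0. r > 0"
    using eventually_nhds_in_open[of "{0<..}" r0] r0 by simp
  obtain \<delta>1 where \<delta>1: "\<delta>1 > 0" and arcs: "\<And>r w. r \<in> ball r0 \<delta>1 \<Longrightarrow>
      w \<in> peaks (critical_points p r) (sq_modulus p r) \<Longrightarrow>
      \<exists>s. continuous_on (ball r0 \<delta>1) s \<and> s r = w \<and>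
        (\<forall>r'\<in>ball r0 \<delta>1. s r' \<in> peaks (critical_points p r') (sq_modulus p r'))"
  proof (rule peaks_along_sections[of "critical_points p" K r0 "sq_modulus p" L])
    show "\<forall>\<^sub>F r in nhds r0. finite (critical_points p r) \<and> card (critical_points p r) = K"
      using card pos by eventually_elim (simp add: finite_critical_points)
    show "\<forall>\<^sub>F r in nhds r0. \<forall>y\<in>critical_points p r. \<forall>e>0. \<forall>\<^sub>F r' in nhds r.
        \<exists>x\<in>critical_points p r'. dist x y < e"
      using pos by eventually_elim (use critical_points_lower_hemicontinuous in blast)
    show "\<forall>\<^sub>F r in nhds r0. \<forall>x\<in>critical_points p r. x \<noteq> 0 \<and> inverse (cnj x) \<in> critical_points p r"
      using pos by eventually_elim
        (use zero_notin_critical_points critical_points_reflect in metis)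
    show "isCont (\<lambda>(r, w). sq_modulus p r w) (r0, y)" if "y \<in> critical_points p r0" for y
    proof -
      have "y \<noteq> 0" using that zero_notin_critical_points[OF r0] by blast
      then show ?thesis
        unfolding sq_modulus_def case_prod_beta by (intro continuous_intros) auto
    qed
    show "sq_modulus p r w \<in> \<real>" if "cmod w = 1" for r w
      using that by (simp only: sq_modulus_on_circle Reals_of_real)
  qed (use vals in auto)
  define \<delta> where "\<delta> = min \<delta>1 r0"
  show thesis
  proof (rule that)
    show "\<delta> > 0" using \<delta>1 r0 by (simp add: \<delta>_def)
    fix z assume z: "z \<in> max_modulus_set (poly p)" "cmod z \<in> ball r0 \<delta>"
    have sub: "ball r0 \<delta> \<subseteq> ball r0 \<delta>1" by (auto simp: \<delta>_def)
    have gt: "r > 0" if "r \<in> ball r0 \<delta>" for r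
      using that by (auto simp: \<delta>_def dist_real_def)
    define w where "w = z / of_real (cmod z)"
    have w: "cmod w = 1" "z = of_real (cmod z) * w"
      using gt[OF z(2)] by (auto simp: w_def norm_divide)
    then have "w \<in> peaks (critical_points p (cmod z)) (sq_modulus p (cmod z))"
      using z max_modulus_set_iff_peaks[OF gt[OF z(2)], of w p] by simp
    then obtain s where s: "continuous_on (ball r0 \<delta>1) s" "s (cmod z) = w"
        "\<And>r. r \<in> ball r0 \<delta>1 \<Longrightarrow> s r \<in> peaks (critical_points p r) (sq_modulus p r)"
      using arcs[of "cmod z" w] z(2) sub by blast
    have s1: "cmod (s r) = 1" if "r \<in> ball r0 \<delta>" for r
      using s(3) that sub unfolding peaks_def by blast
    define C where "C = (\<lambda>r. of_real r * s r) ` ball r0 \<delta>"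
    have "connected C"
      unfolding C_def
      by (intro connected_continuous_image continuous_intros continuous_on_subset[OF s(1) sub]) simp
    moreover have "C \<subseteq> max_modulus_set (poly p)"
      unfolding C_def using s(3) s1 gt sub max_modulus_set_iff_peaks by auto
    moreover have "z \<in> C"
      unfolding C_def using w(2) s(2) z(2) by (intro image_eqI[of _ _ "cmod z"]) simp_all
    moreover have "cmod ` C = ball r0 \<delta>"
    proof -
      have "cmod (of_real r * s r) = r" if "r \<in> ball r0 \<delta>" for r
        using s1[OF that] gt[OF that] by (simp add: norm_mult)
      then show ?thesis unfolding C_def image_image by (simp cong: image_cong_simp)
    qed
    ultimately show "\<exists>C. connected C \<and> C \<subseteq> max_modulus_set (poly p) \<and> z \<in> C \<and> cmod ` C = ball r0 \<delta>"
      by blast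
  qed
qed

text \<open>A component contains every arc that it meets, so the set of its moduli is locally all or nothing in
  \<open>I\<close>.\<close>

lemma component_covers_interval:
  assumes \<Gamma>: "\<Gamma> \<in> components (max_modulus_set (poly p))"
    and I: "connected I" "I \<subseteq> {0<..}"
    and card: "\<And>r0. r0 \<in> I \<Longrightarrow> \<forall>\<^sub>F r in nhds r0. card (critical_points p r) = K"
    and vals: "\<And>r0. r0 \<in> I \<Longrightarrow> \<forall>\<^sub>F r in nhds r0. card (sq_modulus p r ` critical_points p r) = L"
    and "a \<in> I" "a \<in> cmod ` \<Gamma>" "b \<in> I"
  shows "b \<in> cmod ` \<Gamma>"
proof (rule connected_induction_simple[where P = "\<lambda>r. r \<in> cmod ` \<Gamma>",
      OF I(1) \<open>a \<in> I\<close> \<open>b \<in> I\<close> \<open>a \<in> cmod ` \<Gamma>\<close>])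
  fix r0 assume r0: "r0 \<in> I"
  then have "r0 > 0" using I(2) by auto
  then obtain \<delta> where \<delta>: "\<delta> > 0" and arc:
    "\<And>z. z \<in> max_modulus_set (poly p) \<Longrightarrow> cmod z \<in> ball r0 \<delta> \<Longrightarrow>
       \<exists>C. connected C \<and> C \<subseteq> max_modulus_set (poly p) \<and> z \<in> C \<and> cmod ` C = ball r0 \<delta>"
    using local_arcs[OF _ card[OF r0] vals[OF r0]] by blast
  show "\<exists>T. openin (top_of_set I) T \<and> r0 \<in> T \<and>
      (\<forall>x\<in>T. \<forall>y\<in>T. x \<in> cmod ` \<Gamma> \<longrightarrow> y \<in> cmod ` \<Gamma>)"
  proof (intro exI[of _ "I \<inter> ball r0 \<delta>"] conjI ballI impI)
    show "openin (top_of_set I) (I \<inter> ball r0 \<delta>)" by (intro openin_open_Int) simp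
    show "r0 \<in> I \<inter> ball r0 \<delta>" using r0 \<delta> by simp
    fix x y assume x: "x \<in> I \<inter> ball r0 \<delta>" and y: "y \<in> I \<inter> ball r0 \<delta>" and "x \<in> cmod ` \<Gamma>"
    then obtain z where z: "z \<in> \<Gamma>" "x = cmod z" by blast
    have "z \<in> max_modulus_set (poly p)" using in_components_subset[OF \<Gamma>] z(1) by blast
    moreover have "cmod z \<in> ball r0 \<delta>" using x z(2) by simp
    ultimately obtain C where C: "connected C" "C \<subseteq> max_modulus_set (poly p)" "z \<in> C"
        "cmod ` C = ball r0 \<delta>"
      using arc by meson
    then have "C \<subseteq> \<Gamma>"
      using components_maximal[OF \<Gamma> C(1,2)] z(1) by blast
    then have "ball r0 \<delta> \<subseteq> cmod ` \<Gamma>"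
      unfolding C(4)[symmetric] by (rule image_mono)
    then show "y \<in> cmod ` \<Gamma>" using y by (meson IntD2 subsetD)
  qed
qed

text \<open>The exceptional radii together with \<open>0\<close> form a finite set \<open>S\<close>, and \<open>gap s\<close> is the interval from \<open>s\<close>
  to the next element of \<open>S\<close>, or to \<open>\<infinity>\<close>. A component that contains no point with modulus in \<open>S\<close>
  covers a gap and so meets the circle chosen in it.\<close>

lemma finite_components_max_modulus_set:
  "finite (components (max_modulus_set (poly p)))"
proof -
  let ?M = "max_modulus_set (poly p)"
  obtain K where K: "finite {r. r > 0 \<and> card ((\<lambda>w. w) ` critical_points p r) \<noteq> K}"
    using generic_number_of_critical_values[of "\<lambda>r w. w"] tuple_laurent_coordinate by blast
  obtain L where L: "finite {r. r > 0 \<and> card (sq_modulus p r ` critical_points p r) \<noteq> L}"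
    using generic_number_of_critical_values[OF tuple_laurent_sq_modulus] by blast
  define S where "S = insert 0 ({r. r > 0 \<and> card (critical_points p r) \<noteq> K} \<union>
      {r. r > 0 \<and> card (sq_modulus p r ` critical_points p r) \<noteq> L})"
  have S: "finite S" "0 \<in> S" "\<And>s. s \<in> S \<Longrightarrow> s \<ge> 0"
    using K L by (auto simp: S_def)
  define gap where "gap s = {r. s < r \<and> (\<forall>s'\<in>S. s < s' \<longrightarrow> r < s')}" for s
  have gap_pos: "gap s \<subseteq> {0<..}" and gap_S: "gap s \<inter> S = {}" if "s \<in> S" for s
    using S(3)[OF that] by (auto simp: gap_def)
  have gap_connected: "connected (gap s)" for s
    by (rule is_interval_connected) (auto simp: is_interval_1 gap_def)
  have good: "\<forall>\<^sub>F r in nhds r0. r > 0 \<and> r \<notin> S" if "s \<in> S" "r0 \<in> gap s" for s r0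
  proof -
    have "open ({0<..} \<inter> - S)" using S(1) by (intro open_Int open_Compl finite_imp_closed) auto
    moreover have "r0 \<in> {0<..} \<inter> - S" using gap_pos gap_S that by blast
    ultimately show ?thesis using eventually_nhds_in_open by fastforce
  qed
  define c where "c s = (SOME r. r \<in> gap s)" for s
  define Z where "Z = (\<Union>r\<in>S \<union> c ` S. {z \<in> ?M. cmod z = r})"
  show ?thesis
  proof (rule finite_components_if_hitting_finite)
    show "finite Z"
      unfolding Z_def using S(1) finite_max_modulus_set_on_circle by blast
    fix \<Gamma> assume \<Gamma>: "\<Gamma> \<in> components ?M"
    then obtain z where z: "z \<in> \<Gamma>" using in_components_nonempty by blast
    have "\<exists>r\<in>S \<union> c ` S. r \<in> cmod ` \<Gamma>"
    proof (cases "cmod z \<in> S")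
      case True
      then show ?thesis using z by blast
    next
      case False
      define s where "s = Max {s \<in> S. s < cmod z}"
      have "cmod z \<noteq> 0" using False S(2) by auto
      then have "0 \<in> {s \<in> S. s < cmod z}" using S(2) by simp
      then have "s \<in> {s \<in> S. s < cmod z}"
        unfolding s_def using S(1) by (intro Max_in) auto
      moreover have "s' \<le> s" if "s' \<in> S" "s' < cmod z" for s'
        unfolding s_def using S(1) that by (intro Max_ge) auto
      ultimately have s: "s \<in> S" "s < cmod z" "\<And>s'. s' \<in> S \<Longrightarrow> s' < cmod z \<Longrightarrow> s' \<le> s"
        by blast+
      have "cmod z < s'" if "s' \<in> S" "s < s'" for s'
        using s(3)[OF that(1)] that False by (cases "cmod z" s' rule: linorder_cases) auto
      then have z_gap: "cmod z \<in> gap s"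
        using s(2) by (simp add: gap_def)
      then have "c s \<in> gap s" unfolding c_def by (meson someI)
      moreover have "c s \<in> cmod ` \<Gamma>"
      proof (rule component_covers_interval[OF \<Gamma> gap_connected gap_pos[OF s(1)] _ _ z_gap])
        fix r0 assume "r0 \<in> gap s"
        from good[OF s(1) this]
        show "\<forall>\<^sub>F r in nhds r0. card (critical_points p r) = K"
          "\<forall>\<^sub>F r in nhds r0. card (sq_modulus p r ` critical_points p r) = L"
          by (eventually_elim, simp add: S_def)+
      qed (use z \<open>c s \<in> gap s\<close> in auto)
      ultimately show ?thesis using s(1) by blast
    qed
    then show "\<Gamma> \<inter> Z \<noteq> {}"
      using in_components_subset[OF \<Gamma>] unfolding Z_def by auto
  qed
qed

end

section \<open>Reduction to this case\<close>

lemma max_modulus_set_monom_mult: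
  "max_modulus_set (poly (monom 1 l * q)) = max_modulus_set (poly q)"
proof (intro set_eqI)
  fix z :: complex
  show "z \<in> max_modulus_set (poly (monom 1 l * q)) \<longleftrightarrow> z \<in> max_modulus_set (poly q)"
  proof (cases "z = 0")
    case True
    then show ?thesis by (simp add: in_max_modulus_set_poly_iff)
  next
    case False
    have "cmod (poly (monom 1 l * q) u) = cmod z ^ l * cmod (poly q u)" if "cmod u = cmod z" for u
      using that by (simp add: poly_monom norm_mult norm_power)
    then show ?thesis using False by (auto simp: in_max_modulus_set_poly_iff)
  qed
qed

theorem theorem1p4:
  fixes p :: "complex poly"
  shows "finite {\<Gamma>. \<exists>r. discontinuity_of_modulus (poly p) r \<Gamma>}"
proof -
  have degree_0: "finite (components (max_modulus_set (poly [:a:])))" for a :: complex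
  proof -
    have "max_modulus_set (poly [:a:]) = UNIV"
      by (auto simp: in_max_modulus_set_poly_iff)
    then show ?thesis by simp
  qed
  have "finite (components (max_modulus_set (poly p)))"
  proof (cases "p = 0")
    case True
    then show ?thesis using degree_0[of 0] by simp
  next
    case False
    then obtain q where q: "p = [:- 0, 1:] ^ order 0 p * q" "\<not> [:- 0, 1:] dvd q"
      using order_decomp by blast
    have p: "p = monom 1 (order 0 p) * q"
      using q(1) by (simp add: monom_altdef)
    have q0: "coeff q 0 \<noteq> 0"
      using q(2) by (simp only: poly_0_coeff_0[symmetric] poly_eq_0_iff_dvd) simp
    have "finite (components (max_modulus_set (poly q)))"
    proof (cases "degree q = 0")
      case True
      then show ?thesis using degree_0 by (metis degree_eq_zeroE)
    next
      case False
      then show ?thesis using finite_components_max_modulus_set q0 by blast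
    qed
    then show ?thesis by (subst p) (simp add: max_modulus_set_monom_mult)
  qed
  then show ?thesis
    by (rule finite_subset[rotated]) (auto simp: discontinuity_of_modulus_def)
qed

end
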